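(* Let $(X,\Delta)$ be a metric space and let $\mathcal{U}=(U_\alpha)_{\alpha\in\kappa}$ be a pointwise finite open cover of $X$ with Lebesgue number $L>0$ and multiplicity $M\in\mathbb{N}$, $M\ge1$. Let $p\in[1,\infty)$. Then the functions $$\lambda_\alpha(x)=\frac{\delta_\alpha(x)^p}{\sum_{\beta\in\kappa}\delta_\beta(x)^p},\qquad \alpha\in\kappa,$$ constitute a continuous partition of unity $\Lambda=(\lambda_\alpha)_{\alpha\in\kappa}$ subordinate to $\mathcal{U}$. For every $\mu\subseteq\kappa$ let $\lambda_\mu:=\sum_{\alpha\in\mu}\lambda_\alpha$. Then $$\forall\mu\subseteq\kappa:\ \forall x,y\in X:\quad |\lambda_\mu(x)-\lambda_\mu(y)|\le p\,\frac{\max(1,M-1)^{1/p}}{L}\,\Delta(x,y).$$ If $X$ has the approximate midpoint property, then for all $\mu\subseteq\kappa$ and all $x,y\in X$ $$|\lambda_\mu(x)-\lambda_\mu(y)|\le p\,2^{1-\frac1p}\,\frac{(M-1)^{1/p}}{2L}\,\Delta(x,y),$$ $$|\lambda_\mu(x)-\lambda_\mu(y)|\le p\,C_p\,\frac{M-1}{2L}\,\Delta(x,y),$$ where $$C_p:=\max_{\eta\in[1/2,1]}\frac{\eta^{p-1}}{\eta^p+(1-\eta)^p}\in[1,2)$$ depends only on $p$.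
   Context: An open cover $\mathcal{U}=(U_\alpha)_{\alpha\in\kappa}$ of $X$ is an indexed family of open sets with union $X$. It is pointwise finite if each point lies in $U_\alpha$ for only finitely many $\alpha$. It has multiplicity $M$ if each point of $X$ lies in $U_\alpha$ for at most $M$ indices $\alpha$. A number $L>0$ is a Lebesgue number of $\mathcal{U}$ if for every $x\in X$ there is $\alpha\in\kappa$ with $\mathcal{B}(x,L)\subseteq U_\alpha$, where $\mathcal{B}(x,L)$ is the open ball. A metric space $X$ has the approximate midpoint property if for all $x,y\in X$ and $\epsilon>0$ there is $z\in X$ with $\max(\Delta(x,z),\Delta(z,y))\le\Delta(x,y)/2+\epsilon$. A partition of unity over $X$ is a family $(\lambda_\alpha)_{\alpha\in\kappa}$ of continuous functions $\lambda_\alpha:X\to[0,\infty)$ such that at each point only finitely many are nonzero and their sum is $1$; it is subordinate to $\mathcal{U}$ if $\{\lambda_\alpha>0\}\subseteq U_\alpha$ for every $\alpha\in\kappa$. The distance functions are $\delta_\alpha(x):=\Delta(x,X\setminus U_\alpha)=\inf_{y\in X\setminus U_\alpha}\Delta(x,y)$ (equal to $\infty$ if $U_\alpha=X$). Convention if $U_\alpha=X$ for some $\alpha$: then $\lambda_\alpha$ is the constant $1/N$ for each $\alpha$ with $U_\alpha=X$, where $N$ is the number of such indices, and all other $\lambda_\alpha$ are zero. *)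

theory Defs
  imports "HOL-Analysis.Analysis"
begin

definition open_cover :: "'k set \<Rightarrow> ('k \<Rightarrow> 'a::topological_space set) \<Rightarrow> bool" where
  "open_cover K U \<longleftrightarrow> (\<forall>\<alpha>\<in>K. open (U \<alpha>)) \<and> (\<Union>\<alpha>\<in>K. U \<alpha>) = UNIV"

definition pointwise_finite :: "'k set \<Rightarrow> ('k \<Rightarrow> 'a set) \<Rightarrow> bool" where
  "pointwise_finite K U \<longleftrightarrow> (\<forall>x. finite {\<alpha>\<in>K. x \<in> U \<alpha>})"

text \<open>Finiteness is required explicitly, since \<^const>\<open>card\<close> of an infinite set is 0.\<close>
definition has_multiplicity :: "'k set \<Rightarrow> ('k \<Rightarrow> 'a set) \<Rightarrow> nat \<Rightarrow> bool" where
  "has_multiplicity K U M \<longleftrightarrow>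
     (\<forall>x. finite {\<alpha>\<in>K. x \<in> U \<alpha>} \<and> card {\<alpha>\<in>K. x \<in> U \<alpha>} \<le> M)"

definition lebesgue_number :: "'k set \<Rightarrow> ('k \<Rightarrow> 'a::metric_space set) \<Rightarrow> real \<Rightarrow> bool" where
  "lebesgue_number K U L \<longleftrightarrow> L > 0 \<and> (\<forall>x. \<exists>\<alpha>\<in>K. ball x L \<subseteq> U \<alpha>)"

definition approx_midpoint_property :: "'a::metric_space set \<Rightarrow> bool" where
  "approx_midpoint_property X \<longleftrightarrow>
     (\<forall>x\<in>X. \<forall>y\<in>X. \<forall>\<epsilon>>0. \<exists>z\<in>X. max (dist x z) (dist z y) \<le> dist x y / 2 + \<epsilon>)"

text \<open>Index sets may be infinite, so sums over indices are taken with \<^const>\<open>supp_sum\<close>,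
  the sum over the indices with nonzero value.\<close>
definition partition_of_unity :: "'k set \<Rightarrow> ('k \<Rightarrow> 'a::topological_space \<Rightarrow> real) \<Rightarrow> bool" where
  "partition_of_unity K \<Lambda> \<longleftrightarrow>
     (\<forall>\<alpha>\<in>K. continuous_on UNIV (\<Lambda> \<alpha>) \<and> (\<forall>x. \<Lambda> \<alpha> x \<ge> 0)) \<and>
     (\<forall>x. finite {\<alpha>\<in>K. \<Lambda> \<alpha> x \<noteq> 0} \<and> supp_sum (\<lambda>\<alpha>. \<Lambda> \<alpha> x) K = 1)"

definition subordinate_to ::
    "'k set \<Rightarrow> ('k \<Rightarrow> 'a \<Rightarrow> real) \<Rightarrow> ('k \<Rightarrow> 'a set) \<Rightarrow> bool" where
  "subordinate_to K \<Lambda> U \<longleftrightarrow> (\<forall>\<alpha>\<in>K. {x. \<Lambda> \<alpha> x > 0} \<subseteq> U \<alpha>)"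

text \<open>In \<^typ>\<open>ereal\<close> the infimum over the empty set is \<open>\<infinity>\<close>, which is the
  intended value if \<open>V\<close> is the whole space (\<^const>\<open>infdist\<close> would give 0).\<close>
definition dist_compl :: "'a::metric_space set \<Rightarrow> 'a \<Rightarrow> ereal" where
  "dist_compl V x = (INF y\<in>- V. ereal (dist x y))"

text \<open>In the last branch no \<open>U \<beta>\<close> is the whole space, so all distances are finite.\<close>
definition cover_fun :: "'k set \<Rightarrow> ('k \<Rightarrow> 'a::metric_space set) \<Rightarrow> real \<Rightarrow> 'k \<Rightarrow> 'a \<Rightarrow> real" where
  "cover_fun K U p \<alpha> x =
     (if \<exists>\<beta>\<in>K. U \<beta> = UNIV
      then if U \<alpha> = UNIV then 1 / real (card {\<beta>\<in>K. U \<beta> = UNIV}) else 0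
      else real_of_ereal (dist_compl (U \<alpha>) x) powr p /
           supp_sum (\<lambda>\<beta>. real_of_ereal (dist_compl (U \<beta>) x) powr p) K)"

definition cover_fun_sum ::
    "'k set \<Rightarrow> ('k \<Rightarrow> 'a::metric_space set) \<Rightarrow> real \<Rightarrow> 'k set \<Rightarrow> 'a \<Rightarrow> real" where
  "cover_fun_sum K U p \<mu> x = supp_sum (\<lambda>\<alpha>. cover_fun K U p \<alpha> x) \<mu>"

definition C_ratio :: "real \<Rightarrow> real \<Rightarrow> real" where
  "C_ratio p \<eta> = \<eta> powr (p - 1) / (\<eta> powr p + (1 - \<eta>) powr p)"

definition C_const :: "real \<Rightarrow> real" where
  "C_const p = (GREATEST c. c \<in> C_ratio p ` {1/2..1})"

end

theory Submission
  imports Defs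
begin

text \<open>
  If some \<open>U \<alpha>\<close> is the whole space, all functions are constant. Otherwise every \<open>\<delta>\<^sub>\<alpha>\<close> is a finite
  1-Lipschitz function that is positive exactly on \<open>U \<alpha>\<close>, and the Lebesgue number gives
  \<open>max \<delta>\<^sub>\<alpha>(x) \<ge> L\<close>. The point is the Lipschitz estimate; continuity of each \<open>\<lambda>\<^sub>\<alpha>\<close> is its case
  \<open>\<mu> = {\<alpha>}\<close>.

  Fix \<open>x\<close>, \<open>y\<close> and \<open>\<mu>\<close>, put \<open>d = dist x y\<close>, and let \<open>f\<close>, \<open>g\<close> (resp. \<open>f'\<close>, \<open>g'\<close>) be the
  \<open>p\<close>-norms of the families \<open>\<delta>\<^sub>\<alpha>(x)\<close> (resp. \<open>\<delta>\<^sub>\<alpha>(y)\<close>) over \<open>\<mu>\<close> and over its complement, so that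
  \<open>\<lambda>\<^sub>\<mu>(x) = f\<^sup>p / (f\<^sup>p + g\<^sup>p)\<close>. Suppose \<open>\<lambda>\<^sub>\<mu>(x) > \<lambda>\<^sub>\<mu>(y)\<close>. The difference is controlled by the
  cross difference \<open>f g' - f' g = f (g' - g) + g (f - f')\<close> (lemma \<open>powr_ratio_diff_le\<close>), and only
  upper bounds of \<open>f - f'\<close> and \<open>g' - g\<close> are wanted. By Minkowski these are \<open>m\<^bsup>1/p\<^esup> d\<close> and
  \<open>n\<^bsup>1/p\<^esup> d\<close>, where \<open>m\<close> counts the indices in \<open>\<mu>\<close> alive at \<open>x\<close> and \<open>n\<close> those outside \<open>\<mu>\<close> alive at
  \<open>y\<close>. If \<open>d < L\<close>, the index with the largest \<open>\<delta>\<^sub>\<alpha>(x)\<close> is alive at both points, hence one of the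
  two counts misses an index and is at most \<open>M - 1\<close>; in the cases where the other one is not,
  one of the four norms vanishes and the bound persists (lemmas \<open>crossing_supports_card\<close> and
  \<open>cross_difference_le\<close>). With \<open>R\<^sup>p\<close> a lower bound for the denominators this gives the local
  Lipschitz constant \<open>p (M - 1)\<^bsup>1/p\<^esup> / R\<close>. The first estimate is \<open>R = L\<close>; for \<open>d \<ge> L\<close> its right-hand
  side is at least 1.

  Under the approximate midpoint property two things improve. Local Lipschitz bounds become global
  by repeated halving (lemma \<open>local_lipschitz_imp_lipschitz\<close>). Moreover the two largest values
  \<open>s \<ge> t\<close> among the \<open>\<delta>\<^sub>\<alpha>(x)\<close> satisfy \<open>s + t \<ge> 2 L\<close>: moving from \<open>x\<close> by slightly more than \<open>s - L\<close>
  towards the complement of the set realising \<open>s\<close> leads to a point where another \<open>\<delta>\<^sub>\<gamma>\<close> must be at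
  least \<open>L\<close>, hence at least about \<open>2 L - s\<close> at \<open>x\<close> (lemma \<open>two_deepest\<close>). By convexity the denominators are at least \<open>2 L\<^sup>p\<close>, so
  \<open>R = 2\<^bsup>1/p\<^esup> L\<close> is admissible, which is the second estimate. For the third one the power sums
  \<open>f\<^sup>p\<close>, \<open>g\<^sup>p\<close> themselves are compared, each entry moving by at most \<open>p c\<^bsup>p-1\<^esup> d\<close> with \<open>c\<close> the
  largest entry at either point, which on a small scale differs little from the largest entry at
  each of them; writing \<open>s = \<eta> (s + t)\<close> turns \<open>s\<^bsup>p-1\<^esup> / (s\<^sup>p + t\<^sup>p)\<close> into
  \<open>C_ratio p \<eta> / (s + t) \<le> C_p / (2 L)\<close>.
\<close>

section \<open>Power sums and their ratios\<close>

text \<open>The graph of \<open>x\<^sup>p\<close> lies above its tangents. For \<open>p = 1\<close> and \<open>y = 0\<close> the slope is read as 0,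
  because \<open>0 powr 0 = 0\<close>; the inequality then still holds since \<open>x \<ge> 0\<close>.\<close>
lemma powr_tangent_le:
  fixes x y p :: real
  assumes "p \<ge> 1" "x \<ge> 0" "y \<ge> 0"
  shows "y powr p + p * y powr (p - 1) * (x - y) \<le> x powr p"
proof -
  consider "y = 0" | "x = 0" "y > 0" | "x > 0" "y > 0" using assms by linarith
  then show ?thesis
  proof cases
    case 2
    have "y powr (p - 1) * y = y powr p" using 2 by (simp add: powr_diff)
    moreover have "y powr p \<le> p * y powr p" using assms mult_right_mono[of 1 p "y powr p"] by simp
    ultimately show ?thesis using 2 assms by (simp add: mult.assoc)
  next
    case 3
    have "x powr p - y powr p \<ge> (p * y powr (p - 1)) * (x - y)"
    proof (rule convex_on_imp_above_tangent)
      show "convex_on {0<..} (\<lambda>x. x powr p)" using powr_convex assms by blast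
      show "((\<lambda>x. x powr p) has_real_derivative p * y powr (p - 1)) (at y within {0<..})"
        using 3 by (intro has_field_derivative_at_within[OF has_real_derivative_powr])
    qed (use 3 in \<open>auto simp: interior_open\<close>)
    then show ?thesis by simp
  qed simp
qed

lemma powr_diff_le:
  fixes u w c p :: real
  assumes "p \<ge> 1" "0 \<le> w" "w \<le> u" "u \<le> c"
  shows "u powr p - w powr p \<le> p * c powr (p - 1) * (u - w)"
proof -
  have "u powr p - w powr p \<le> p * u powr (p - 1) * (u - w)"
    using powr_tangent_le[of p w u] assms by (simp add: algebra_simps)
  also have "\<dots> \<le> p * c powr (p - 1) * (u - w)"
    using assms by (intro mult_right_mono mult_left_mono powr_mono2) auto
  finally show ?thesis .
qed

lemma powr_convex_nonneg:
  fixes x y w p :: real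
  assumes "p \<ge> 1" "x \<ge> 0" "y \<ge> 0" "0 \<le> w" "w \<le> 1"
  shows "(w * x + (1 - w) * y) powr p \<le> w * x powr p + (1 - w) * y powr p"
proof -
  define z where "z = w * x + (1 - w) * y"
  have z: "z \<ge> 0" using assms by (simp add: z_def)
  have "w * (z powr p + p * z powr (p - 1) * (x - z)) + (1 - w) * (z powr p + p * z powr (p - 1) * (y - z))
      = z powr p + p * z powr (p - 1) * (w * x + (1 - w) * y - z)"
    by (simp add: algebra_simps)
  moreover have "w * (z powr p + p * z powr (p - 1) * (x - z)) \<le> w * x powr p"
    using powr_tangent_le[of p x z] assms z by (intro mult_left_mono) auto
  moreover have "(1 - w) * (z powr p + p * z powr (p - 1) * (y - z)) \<le> (1 - w) * y powr p"
    using powr_tangent_le[of p y z] assms z by (intro mult_left_mono) auto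
  ultimately show ?thesis by (simp add: z_def)
qed

text \<open>Minkowski's inequality: after normalising both families to norm 1, the sum becomes a convex
  combination with weight \<open>w = A / (A + B)\<close>, to which convexity of \<open>x\<^sup>p\<close> applies entrywise.\<close>
lemma minkowski_sum_powr:
  fixes a b :: "'i \<Rightarrow> real"
  assumes "finite I" "p \<ge> 1" "\<And>i. i \<in> I \<Longrightarrow> a i \<ge> 0" "\<And>i. i \<in> I \<Longrightarrow> b i \<ge> 0"
  shows "(\<Sum>i\<in>I. (a i + b i) powr p) powr (1 / p)
           \<le> (\<Sum>i\<in>I. a i powr p) powr (1 / p) + (\<Sum>i\<in>I. b i powr p) powr (1 / p)"
proof -
  define A where "A = (\<Sum>i\<in>I. a i powr p) powr (1 / p)"
  define B where "B = (\<Sum>i\<in>I. b i powr p) powr (1 / p)"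
  have AB0: "A \<ge> 0" "B \<ge> 0" by (auto simp: A_def B_def)
  have Ap: "A powr p = (\<Sum>i\<in>I. a i powr p)" and Bp: "B powr p = (\<Sum>i\<in>I. b i powr p)"
    using assms by (auto simp: A_def B_def powr_powr sum_nonneg)
  consider "A = 0" | "B = 0" | "A > 0" "B > 0" using AB0 by linarith
  then show ?thesis
  proof cases
    case 1
    then have "(\<Sum>i\<in>I. a i powr p) = 0" by (simp add: A_def)
    then have "\<And>i. i \<in> I \<Longrightarrow> a i = 0"
      using assms by (auto simp: sum_nonneg_eq_0_iff)
    then show ?thesis by simp
  next
    case 2
    then have "(\<Sum>i\<in>I. b i powr p) = 0" by (simp add: B_def)
    then have "\<And>i. i \<in> I \<Longrightarrow> b i = 0"
      using assms by (auto simp: sum_nonneg_eq_0_iff)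
    then show ?thesis by simp
  next
    case 3
    define w where "w = A / (A + B)"
    have w: "0 \<le> w" "w \<le> 1" "1 - w = B / (A + B)" using 3 by (auto simp: w_def field_simps)
    have wAB: "(A + B) * w = A" "(A + B) * (1 - w) = B" unfolding w(3) using 3 by (auto simp: w_def)
    have le: "(a i + b i) powr p
        \<le> (A + B) powr p * (w * (a i powr p / A powr p) + (1 - w) * (b i powr p / B powr p))"
      if i: "i \<in> I" for i
    proof -
      have "a i + b i = (A + B) * (w * (a i / A) + (1 - w) * (b i / B))"
        using 3 wAB by (simp add: distrib_left flip: mult.assoc)
      then have "(a i + b i) powr p = (A + B) powr p * (w * (a i / A) + (1 - w) * (b i / B)) powr p"
        using 3 i assms w by (simp add: powr_mult)
      also have "\<dots> \<le> (A + B) powr p * (w * (a i / A) powr p + (1 - w) * (b i / B) powr p)"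
        using 3 i assms w by (intro mult_left_mono powr_convex_nonneg) auto
      finally show ?thesis using 3 i assms by (simp add: powr_divide)
    qed
    have "(\<Sum>i\<in>I. (a i + b i) powr p)
        \<le> (\<Sum>i\<in>I. (A + B) powr p * (w * (a i powr p / A powr p) + (1 - w) * (b i powr p / B powr p)))"
      by (intro sum_mono le)
    also have "\<dots> = (A + B) powr p * (w * ((\<Sum>i\<in>I. a i powr p) / A powr p)
        + (1 - w) * ((\<Sum>i\<in>I. b i powr p) / B powr p))"
      by (simp only: sum_distrib_left [symmetric] sum.distrib sum_divide_distrib [symmetric])
    also have "\<dots> = (A + B) powr p" using 3 by (simp flip: Ap Bp)
    finally have "(\<Sum>i\<in>I. (a i + b i) powr p) powr (1 / p) \<le> ((A + B) powr p) powr (1 / p)"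
      using assms by (intro powr_mono2) (auto intro: sum_nonneg)
    also have "\<dots> = A + B" using 3 assms by (simp add: powr_powr)
    finally show ?thesis by (simp add: A_def B_def)
  qed
qed

text \<open>x\<close>
text \<open>The vector with all entries \<open>d\<close> has norm \<open>(card)\<^bsup>1/p\<^esup> d\<close>. Indices with \<open>a i = 0\<close> can be dropped
  before the comparison, so only the support of the larger family \<open>a\<close> is counted, however many
  entries of \<open>b\<close> are positive. This one-sidedness is what keeps the multiplicity at a single point
  in the final constants.\<close>
lemma root_sum_powr_le_add_card:
  fixes a b :: "'i \<Rightarrow> real"
  assumes "finite I" "p \<ge> 1" "d \<ge> 0"
    and "\<And>i. i \<in> I \<Longrightarrow> a i \<ge> 0" "\<And>i. i \<in> I \<Longrightarrow> b i \<ge> 0" "\<And>i. i \<in> I \<Longrightarrow> a i \<le> b i + d"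
  shows "(\<Sum>i\<in>I. a i powr p) powr (1 / p)
           \<le> (\<Sum>i\<in>I. b i powr p) powr (1 / p) + real (card {i\<in>I. a i > 0}) powr (1 / p) * d"
proof -
  let ?J = "{i\<in>I. a i > 0}"
  have "(\<Sum>i\<in>I. a i powr p) = (\<Sum>i\<in>?J. a i powr p)"
    using assms by (intro sum.mono_neutral_right) force+
  also have "\<dots> \<le> (\<Sum>i\<in>?J. (b i + d) powr p)"
    using assms by (intro sum_mono powr_mono2) auto
  finally have "(\<Sum>i\<in>I. a i powr p) powr (1 / p) \<le> (\<Sum>i\<in>?J. (b i + d) powr p) powr (1 / p)"
    using assms by (intro powr_mono2) (auto intro: sum_nonneg)
  also have "\<dots> \<le> (\<Sum>i\<in>?J. b i powr p) powr (1 / p) + (\<Sum>i\<in>?J. d powr p) powr (1 / p)"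
    using assms by (intro minkowski_sum_powr) auto
  also have "(\<Sum>i\<in>?J. b i powr p) powr (1 / p) \<le> (\<Sum>i\<in>I. b i powr p) powr (1 / p)"
    using assms by (intro powr_mono2 sum_mono2) (auto intro: sum_nonneg)
  also have "(\<Sum>i\<in>?J. d powr p) powr (1 / p) = real (card ?J) powr (1 / p) * d"
    using assms by (simp add: powr_mult powr_powr)
  finally show ?thesis by simp
qed

text \<open>x\<close>
text \<open>The analogue without the \<open>p\<close>-th root: the mean value bound on each entry replaces Minkowski.\<close>
lemma sum_powr_diff_le_card:
  fixes a b :: "'i \<Rightarrow> real"
  assumes "finite I" "p \<ge> 1" "d \<ge> 0"
    and "\<And>i. i \<in> I \<Longrightarrow> a i \<ge> 0" "\<And>i. i \<in> I \<Longrightarrow> b i \<ge> 0" "\<And>i. i \<in> I \<Longrightarrow> a i \<le> b i + d"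
    and "\<And>i. i \<in> I \<Longrightarrow> a i \<le> c"
  shows "(\<Sum>i\<in>I. a i powr p) - (\<Sum>i\<in>I. b i powr p)
           \<le> real (card {i\<in>I. a i > 0}) * (p * c powr (p - 1) * d)"
proof -
  let ?J = "{i\<in>I. a i > 0}"
  have "(\<Sum>i\<in>I. a i powr p) = (\<Sum>i\<in>?J. a i powr p)"
    using assms by (intro sum.mono_neutral_right) force+
  moreover have "(\<Sum>i\<in>?J. b i powr p) \<le> (\<Sum>i\<in>I. b i powr p)"
    using assms by (intro sum_mono2) auto
  moreover have "(\<Sum>i\<in>?J. a i powr p) - (\<Sum>i\<in>?J. b i powr p) \<le> (\<Sum>i\<in>?J. p * c powr (p - 1) * d)"
    unfolding sum_subtractf[symmetric]
  proof (rule sum_mono)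
    fix i assume i: "i \<in> ?J"
    show "a i powr p - b i powr p \<le> p * c powr (p - 1) * d"
    proof (cases "b i \<le> a i")
      case True
      then have "a i powr p - b i powr p \<le> p * c powr (p - 1) * (a i - b i)"
        using i assms by (intro powr_diff_le) auto
      also have "\<dots> \<le> p * c powr (p - 1) * d"
        using i assms by (intro mult_left_mono) (auto simp: algebra_simps)
      finally show ?thesis .
    next
      case False
      then have "a i powr p \<le> b i powr p" using i assms by (intro powr_mono2) auto
      moreover have "0 \<le> p * c powr (p - 1) * d" using assms by simp
      ultimately show ?thesis by linarith
    qed
  qed
  ultimately show ?thesis by simp
qed

text \<open>The cross difference can be split with weights taken from either pair,
  \<open>f (g' - g) + g (f - f')\<close> or \<open>f' (g' - g) + g' (f - f')\<close>. A factor \<open>k1\<close> or \<open>k2\<close> above \<open>N\<close> is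
  harmless if its weight in one of the splittings is zero; this is why the conclusion is a
  disjunction.\<close>
lemma cross_difference_le:
  fixes f g f' g' :: real
  assumes nn: "f \<ge> 0" "g \<ge> 0" "f' \<ge> 0" "g' \<ge> 0" and t: "t \<ge> 0"
    and df: "f - f' \<le> k1 * t" and dg: "g' - g \<le> k2 * t"
    and k: "k2 \<le> N \<and> (k1 \<le> N \<or> g = 0) \<or> f' = 0 \<and> k1 \<le> N"
  shows "f * g' - f' * g \<le> N * t * (f + g) \<or> f * g' - f' * g \<le> N * t * (f' + g')"
proof -
  have mono: "h * e \<le> N * t * h" if "h \<ge> 0" "e \<le> k * t" "k \<le> N" for h e k :: real
  proof -
    have "e \<le> N * t" using that t mult_right_mono[of k N t] by linarith
    then show ?thesis using that mult_left_mono[of e "N * t" h] by (simp add: mult.commute)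
  qed
  show ?thesis
  proof (cases "f' = 0 \<and> k1 \<le> N")
    case True
    have "g' * (f - f') \<le> N * t * g'" using True df nn by (intro mono) auto
    then show ?thesis using True by (auto simp: algebra_simps)
  next
    case False
    then have k': "k2 \<le> N" "k1 \<le> N \<or> g = 0" using k by auto
    have "f * (g' - g) \<le> N * t * f" using nn dg k' by (intro mono) auto
    moreover have "g * (f - f') \<le> N * t * g" using nn df k' mono[of g "f - f'" k1] by auto
    ultimately show ?thesis by (auto simp: algebra_simps)
  qed
qed

text \<open>x\<close>
text \<open>Dividing by the norms \<open>s\<close>, \<open>s'\<close> yields points \<open>(u, v)\<close>, \<open>(u', v')\<close> of the \<open>p\<close>-unit sphere, where
  the difference \<open>D\<close> of the ratios is both \<open>u\<^sup>p - u'\<^sup>p\<close> and \<open>v'\<^sup>p - v\<^sup>p\<close>. All coordinates are at most 1,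
  hence \<open>D \<le> p (u - u')\<close> and \<open>D \<le> p (v' - v)\<close>; combining these with weights \<open>v\<close>, \<open>u\<close> (or \<open>v'\<close>, \<open>u'\<close>)
  reproduces the cross difference. No path between the two points is needed, so the bound
  holds in spaces without any connectedness.\<close>
lemma powr_ratio_diff_le:
  fixes f g f' g' :: real
  assumes nn: "f \<ge> 0" "g \<ge> 0" "f' \<ge> 0" "g' \<ge> 0" and p: "p \<ge> 1"
    and S: "R > 0" "R powr p \<le> f powr p + g powr p" "R powr p \<le> f' powr p + g' powr p"
    and c: "c \<ge> 0" "f * g' - f' * g \<le> c * (f + g) \<or> f * g' - f' * g \<le> c * (f' + g')"
  shows "f powr p / (f powr p + g powr p) - f' powr p / (f' powr p + g' powr p) \<le> p * c / R"
proof (cases "f powr p / (f powr p + g powr p) \<le> f' powr p / (f' powr p + g' powr p)")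
  case True
  moreover have "0 \<le> p * c / R" using assms by simp
  ultimately show ?thesis by linarith
next
  case False
  define s where "s = (f powr p + g powr p) powr (1 / p)"
  define s' where "s' = (f' powr p + g' powr p) powr (1 / p)"
  have Rp: "R powr p > 0" using S by simp
  have sp: "s powr p = f powr p + g powr p" "s' powr p = f' powr p + g' powr p"
    using p by (auto simp: s_def s'_def powr_powr)
  have Rs: "R \<le> s" "R \<le> s'"
    using S p powr_mono2[of "1 / p" "R powr p" "f powr p + g powr p"]
      powr_mono2[of "1 / p" "R powr p" "f' powr p + g' powr p"]
    by (auto simp: s_def s'_def powr_powr)
  then have s0: "s > 0" "s' > 0" using S by auto
  define u where "u = f / s"
  define v where "v = g / s"
  define u' where "u' = f' / s'"
  define v' where "v' = g' / s'"
  have uv0: "u \<ge> 0" "v \<ge> 0" "u' \<ge> 0" "v' \<ge> 0"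
    using nn s0 by (auto simp: u_def v_def u'_def v'_def)
  have U: "u powr p = f powr p / (f powr p + g powr p)" "u' powr p = f' powr p / (f' powr p + g' powr p)"
    using nn s0 by (auto simp: u_def u'_def powr_divide sp)
  have sum1: "u powr p + v powr p = 1" "u' powr p + v' powr p = 1"
    using nn s0 Rp S by (auto simp: u_def v_def u'_def v'_def powr_divide sp simp flip: add_divide_distrib)
  have le1: "h \<le> 1" if "h \<ge> 0" "h powr p \<le> 1" for h :: real
    using that p powr_mono2[of "1 / p" "h powr p" 1] by (simp add: powr_powr)
  have "u powr p \<le> 1" "v powr p \<le> 1" "u' powr p \<le> 1" "v' powr p \<le> 1"
    using sum1 powr_ge_zero[of u p] powr_ge_zero[of v p] powr_ge_zero[of u' p] powr_ge_zero[of v' p]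
    by linarith+
  then have uv1: "u \<le> 1" "v \<le> 1" "u' \<le> 1" "v' \<le> 1"
    using uv0 le1 by auto
  define D where "D = u powr p - u' powr p"
  have D: "D > 0" "D = v' powr p - v powr p" using False U sum1 by (auto simp: D_def)
  have mono: "h' \<le> h" if "h \<ge> 0" "h' \<ge> 0" "h powr p - h' powr p > 0" for h h' :: real
  proof (rule ccontr)
    assume "\<not> h' \<le> h"
    then have "h powr p \<le> h' powr p" using that p by (intro powr_mono2) auto
    then show False using that by simp
  qed
  have Du: "D \<le> p * (u - u')"
    using powr_diff_le[of p u' u 1] mono[of u u'] uv0 uv1 p D by (auto simp: D_def)
  have Dv: "D \<le> p * (v' - v)"
    using powr_diff_le[of p v v' 1] mono[of v' v] uv0 uv1 p D by auto
  have "D * (u + v) \<le> p * (u * v' - u' * v)"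
    using mult_left_mono[OF Dv uv0(1)] mult_left_mono[OF Du uv0(2)] by (simp add: algebra_simps)
  moreover have "D * (u' + v') \<le> p * (u * v' - u' * v)"
    using mult_left_mono[OF Dv uv0(3)] mult_left_mono[OF Du uv0(4)] by (simp add: algebra_simps)
  moreover have cross: "u * v' - u' * v = (f * g' - f' * g) / (s * s')"
    using s0 by (simp add: u_def v_def u'_def v'_def field_simps)
  moreover have "u + v = (f + g) / s" "u' + v' = (f' + g') / s'"
    by (auto simp: u_def v_def u'_def v'_def add_divide_distrib)
  ultimately have "D * (f + g) / s \<le> (p * (f * g' - f' * g) / s') / s"
    "D * (f' + g') / s' \<le> (p * (f * g' - f' * g) / s) / s'"
    by (simp_all add: mult.commute)
  then have D1: "D * (f + g) \<le> p * (f * g' - f' * g) / s'"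
    and D2: "D * (f' + g') \<le> p * (f * g' - f' * g) / s"
    unfolding divide_le_cancel using s0 by blast+
  have "h + h' > 0" if "h \<ge> 0" "h' \<ge> 0" "R powr p \<le> h powr p + h' powr p" for h h'
  proof (rule ccontr)
    assume "\<not> h + h' > 0"
    then have "h = 0" "h' = 0" using that by auto
    then show False using that Rp by simp
  qed
  then have pos: "f + g > 0" "f' + g' > 0" using nn S by auto
  have key: "D \<le> p * c / R" if "D * h \<le> p * e / r" "e \<le> c * h" "h > 0" "R \<le> r" for h e r
  proof -
    have "D * h \<le> p * (c * h) / r"
      using that S p by (intro order_trans[OF that(1)] divide_right_mono mult_left_mono) auto
    then have "D \<le> p * c / r" using that S by (simp add: field_simps)
    also have "\<dots> \<le> p * c / R" using that S p c by (intro divide_left_mono) auto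
    finally show ?thesis .
  qed
  have "D \<le> p * c / R" using c(2) key[OF D1 _ pos(1) Rs(2)] key[OF D2 _ pos(2) Rs(1)] by blast
  then show ?thesis by (simp add: D_def U)
qed

section \<open>Spaces with approximate midpoints\<close>

text \<open>Approximate midpoints yield approximate points at every division ratio. The slack \<open>c\<close> is an
  invariant of the halving: the midpoint error is chosen so small that the slack stays above \<open>c\<close>, and
  once the distance is below \<open>c\<close> an endpoint will do. Halving always continues on the side of the
  smaller radius, since the larger radius already covers the other half.\<close>
lemma approx_between:
  fixes x y :: "'a::metric_space"
  assumes mid: "approx_midpoint_property (UNIV :: 'a set)"
    and ab: "a > 0" "b > 0" "a + b > dist x y"
  obtains z where "dist x z < a" "dist z y < b"
proof -
  have *: "\<exists>z. dist x z < a \<and> dist z y < b"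
    if "c > 0" "dist x y < 2 ^ n * c" "a > 0" "b > 0" "a + b > dist x y + c" for n c a b and x y :: 'a
    using that
  proof (induction n arbitrary: x y a b)
    case 0
    then have "dist x y < a \<or> dist x y < b" by auto
    then show ?case using 0 by (metis dist_self)
  next
    case (Suc n)
    define e where "e = min ((a + b - dist x y - c) / 4) ((2 ^ Suc n * c - dist x y) / 4)"
    have "e \<le> (a + b - dist x y - c) / 4" "e \<le> (2 ^ Suc n * c - dist x y) / 4"
      unfolding e_def by (rule min.cobounded1, rule min.cobounded2)
    moreover have "e > 0" using Suc.prems by (auto simp: e_def)
    ultimately have e: "e > 0" "4 * e \<le> a + b - dist x y - c" "4 * e \<le> 2 ^ Suc n * c - dist x y"
      by auto
    obtain z where "max (dist x z) (dist z y) \<le> dist x y / 2 + e"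
      using mid e unfolding approx_midpoint_property_def by blast
    then have z: "dist x z \<le> dist x y / 2 + e" "dist z y \<le> dist x y / 2 + e" by auto
    show ?case
    proof (cases "a \<le> b")
      case True
      have "\<exists>w. dist x w < a \<and> dist w z < b - dist z y"
        by (rule Suc.IH) (use True e z Suc.prems in auto)
      then obtain w where "dist x w < a" "dist w z < b - dist z y" by blast
      then show ?thesis using dist_triangle[of w y z] by (intro exI[of _ w]) auto
    next
      case False
      have "\<exists>w. dist z w < a - dist x z \<and> dist w y < b"
        by (rule Suc.IH) (use False e z Suc.prems in auto)
      then obtain w where "dist z w < a - dist x z" "dist w y < b" by blast
      then show ?thesis using dist_triangle[of x w z] by (intro exI[of _ w]) auto
    qed
  qed
  define c where "c = (a + b - dist x y) / 2"
  have c: "c > 0" using ab by (simp add: c_def)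
  obtain n where "dist x y / c < 2 ^ n" using real_arch_pow[of 2 "dist x y / c"] by auto
  then have "dist x y < 2 ^ n * c" using c by (simp add: field_simps)
  moreover have "a + b > dist x y + c" using ab by (simp add: c_def field_simps)
  ultimately show thesis using *[of c x y n a b] c ab that by blast
qed

text \<open>Halving brings any two points within the range of the local bound after finitely many steps;
  the errors made at the midpoints can be chosen arbitrarily small, so the constant does not grow.\<close>
lemma local_lipschitz_imp_lipschitz:
  fixes h :: "'a::metric_space \<Rightarrow> real"
  assumes mid: "approx_midpoint_property (UNIV :: 'a set)"
    and r: "r > 0" and C: "C \<ge> 0"
    and loc: "\<And>x y. dist x y < r \<Longrightarrow> \<bar>h x - h y\<bar> \<le> C * dist x y"
  shows "\<bar>h x - h y\<bar> \<le> C * dist x y"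
proof -
  have *: "\<bar>h x - h y\<bar> \<le> C * dist x y" if "dist x y < 2 ^ n * r" for n x y
    using that
  proof (induction n arbitrary: x y)
    case 0
    then show ?case using loc by simp
  next
    case (Suc n)
    show ?case
    proof (rule field_le_epsilon)
      fix \<epsilon> :: real assume \<epsilon>: "\<epsilon> > 0"
      define e where "e = min (\<epsilon> / (2 * (C + 1))) ((2 ^ Suc n * r - dist x y) / 4)"
      have "e \<le> \<epsilon> / (2 * (C + 1))" by (simp add: e_def)
      then have "2 * e * (C + 1) \<le> \<epsilon>" using C by (simp add: field_simps)
      moreover have "e \<le> (2 ^ Suc n * r - dist x y) / 4"
        unfolding e_def by (rule min.cobounded2)
      then have e: "e > 0" "4 * e \<le> 2 ^ Suc n * r - dist x y"
        using Suc.prems \<epsilon> C by (auto simp: e_def)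
      ultimately have eC: "2 * e * C \<le> \<epsilon>" by (simp add: algebra_simps)
      obtain z where "max (dist x z) (dist z y) \<le> dist x y / 2 + e"
        using mid e unfolding approx_midpoint_property_def by blast
      then have z: "dist x z \<le> dist x y / 2 + e" "dist z y \<le> dist x y / 2 + e" by auto
      have "\<bar>h x - h z\<bar> \<le> C * dist x z" "\<bar>h z - h y\<bar> \<le> C * dist z y"
        using z e by (auto intro!: Suc.IH)
      then have "\<bar>h x - h y\<bar> \<le> C * (dist x z + dist z y)" by (simp add: algebra_simps)
      also have "\<dots> \<le> C * (dist x y + 2 * e)" using z C by (intro mult_left_mono) auto
      also have "\<dots> \<le> C * dist x y + \<epsilon>" using eC by (simp add: algebra_simps)
      finally show "\<bar>h x - h y\<bar> \<le> C * dist x y + \<epsilon>" .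
    qed
  qed
  obtain n where "dist x y / r < 2 ^ n" using real_arch_pow[of 2 "dist x y / r"] by auto
  then have "dist x y < 2 ^ n * r" using r by (simp add: field_simps)
  then show ?thesis by (rule *)
qed

section \<open>The constant of the midpoint estimate\<close>

lemma C_const_attained:
  assumes p: "p \<ge> 1"
  obtains \<eta> where "\<eta> \<in> {1/2..1}" "C_ratio p \<eta> = C_const p"
    "\<And>\<zeta>. \<zeta> \<in> {1/2..1} \<Longrightarrow> C_ratio p \<zeta> \<le> C_const p"
proof -
  have "continuous_on {1/2..1} (C_ratio p)"
    unfolding C_ratio_def using p
    by (intro continuous_on_divide continuous_on_add continuous_on_powr' continuous_intros)
       (auto simp: add_nonneg_eq_0_iff)
  then obtain \<eta> where \<eta>: "\<eta> \<in> {1/2..1}" "\<And>\<zeta>. \<zeta> \<in> {1/2..1} \<Longrightarrow> C_ratio p \<zeta> \<le> C_ratio p \<eta>"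
    using continuous_attains_sup[of "{1/2..1}" "C_ratio p"] by auto
  have "C_const p = C_ratio p \<eta>"
    unfolding C_const_def using \<eta> by (intro Greatest_equality) auto
  then show thesis using \<eta> that by auto
qed

lemma C_const_range:
  assumes p: "p \<ge> 1"
  shows "C_const p \<in> {1..<2}"
proof -
  obtain \<eta> where \<eta>: "\<eta> \<in> {1/2..1}" "C_ratio p \<eta> = C_const p"
    "\<And>\<zeta>. \<zeta> \<in> {1/2..1} \<Longrightarrow> C_ratio p \<zeta> \<le> C_const p"
    using C_const_attained[OF p] by blast
  have "C_ratio p 1 = 1" by (simp add: C_ratio_def)
  then have "1 \<le> C_const p" using \<eta>(3)[of 1] by simp
  moreover have "\<eta> powr (p - 1) < 2 * (\<eta> powr p + (1 - \<eta>) powr p)"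
  proof -
    \<comment> \<open>This turns \<open>\<eta> \<ge> 1/2\<close> into the bound 2; for \<open>\<eta> < 1\<close> strictness comes from \<open>(1 - \<eta>)\<^sup>p\<close>.\<close>
    have e: "\<eta> powr p = \<eta> * \<eta> powr (p - 1)" using \<eta> by (simp add: powr_diff)
    show ?thesis
    proof (cases "\<eta> = 1")
      case False
      have "1 * \<eta> powr (p - 1) \<le> 2 * \<eta> * \<eta> powr (p - 1)"
        using \<eta> by (intro mult_right_mono) auto
      moreover have "(1 - \<eta>) powr p > 0" using \<eta> False by simp
      ultimately show ?thesis unfolding e distrib_left mult.assoc by linarith
    qed simp
  qed
  then have "C_ratio p \<eta> < 2"
    using \<eta>(1) by (simp add: C_ratio_def divide_less_eq add_pos_nonneg)
  ultimately show ?thesis using \<eta> by simp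
qed

text \<open>By homogeneity \<open>s\<^bsup>p-1\<^esup> / (s\<^sup>p + t\<^sup>p)\<close> is \<open>C_ratio p \<eta> / (s + t)\<close> with \<open>\<eta> = s / (s + t)\<close>, and
  \<open>t \<le> s\<close> means \<open>\<eta> \<ge> 1/2\<close>.\<close>
lemma powr_div_sum_le_C_const:
  assumes p: "p \<ge> 1" and L: "L > 0" and t: "0 \<le> t" "t \<le> s" "2 * L \<le> s + t"
  shows "s powr (p - 1) \<le> C_const p / (2 * L) * (s powr p + t powr p)"
proof -
  define T where "T = s + t"
  define \<eta> where "\<eta> = s / T"
  have T: "T > 0" "2 * L \<le> T" using t L by (auto simp: T_def)
  have \<eta>: "\<eta> \<in> {1/2..1}" using t T by (auto simp: \<eta>_def T_def field_simps)
  have st: "s = T * \<eta>" "t = T * (1 - \<eta>)" using T by (auto simp: \<eta>_def T_def field_simps)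
  have C: "C_ratio p \<eta> \<le> C_const p" "0 \<le> C_const p"
    using C_const_attained[OF p] \<eta> C_const_range[OF p] by fastforce+
  have q: "\<eta> powr p + (1 - \<eta>) powr p > 0" using \<eta> by (auto intro!: add_pos_nonneg)
  have "s powr (p - 1) = T powr (p - 1) * \<eta> powr (p - 1)" using T \<eta> by (simp add: st(1) powr_mult)
  also have "\<eta> powr (p - 1) = C_ratio p \<eta> * (\<eta> powr p + (1 - \<eta>) powr p)" using q by (simp add: C_ratio_def)
  also have "T powr (p - 1) * \<dots> = C_ratio p \<eta> / T * (s powr p + t powr p)"
    unfolding st using T \<eta> by (simp add: powr_mult powr_diff distrib_left add_divide_distrib mult_ac)
  also have "\<dots> \<le> C_const p / (2 * L) * (s powr p + t powr p)"
    using C T L by (intro mult_right_mono frac_le) auto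
  finally show ?thesis .
qed

section \<open>Comparing the shares of two finite families\<close>

text \<open>The common index \<open>j\<close> lies in \<open>\<mu>\<close> or outside. If it lies in \<open>\<mu>\<close>, the support of \<open>b\<close> outside \<open>\<mu>\<close>
  misses \<open>j\<close>; the support of \<open>a\<close> in \<open>\<mu>\<close> may still have \<open>M\<close> elements, but then it exhausts the
  support of \<open>a\<close>. The other case is symmetric.\<close>
lemma crossing_supports_card:
  fixes a b :: "'i \<Rightarrow> real"
  assumes F: "finite F" "\<mu> \<subseteq> F" and nn: "\<And>i. i \<in> F \<Longrightarrow> a i \<ge> 0" "\<And>i. i \<in> F \<Longrightarrow> b i \<ge> 0"
    and M: "card {i\<in>F. a i > 0} \<le> M" "card {i\<in>F. b i > 0} \<le> M"
    and common: "j \<in> F" "a j > 0" "b j > 0"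
  shows "(card {i\<in>F-\<mu>. b i > 0} \<le> M - 1 \<and> (card {i\<in>\<mu>. a i > 0} \<le> M - 1 \<or> (\<forall>i\<in>F-\<mu>. a i = 0)))
       \<or> ((\<forall>i\<in>\<mu>. b i = 0) \<and> card {i\<in>\<mu>. a i > 0} \<le> M - 1)"
proof -
  have miss: "card A \<le> M - 1" if "A \<subseteq> B" "B \<subseteq> F" "card B \<le> M" "k \<in> B" "k \<notin> A" for A B k
  proof -
    have "card A < card B" using that F by (intro psubset_card_mono) (auto intro: finite_subset)
    then show ?thesis using that by linarith
  qed
  have a: "card {i\<in>\<mu>. a i > 0} \<le> M - 1" if "k \<in> F - \<mu>" "a k > 0" for k
    by (rule miss[of _ "{i\<in>F. a i > 0}" k]) (use that F M in auto)
  have b: "card {i\<in>F-\<mu>. b i > 0} \<le> M - 1" if "k \<in> \<mu>" "b k > 0" for k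
    by (rule miss[of _ "{i\<in>F. b i > 0}" k]) (use that F M in auto)
  show ?thesis
  proof (cases "j \<in> \<mu>")
    case True
    then show ?thesis using a b[of j] common nn(1) by (metis DiffD1 order.order_iff_strict)
  next
    case False
    then show ?thesis using a[of j] b common nn(2) F by (metis DiffI order.order_iff_strict subsetD)
  qed
qed

text \<open>The index \<open>j\<close> common to both supports is what lowers \<open>M\<close> to \<open>M - 1\<close> in the bound.\<close>
lemma share_difference_le_norm:
  fixes a b :: "'i \<Rightarrow> real"
  assumes F: "finite F" "\<mu> \<subseteq> F" and nn: "\<And>i. i \<in> F \<Longrightarrow> a i \<ge> 0" "\<And>i. i \<in> F \<Longrightarrow> b i \<ge> 0"
    and d: "d \<ge> 0" "\<And>i. i \<in> F \<Longrightarrow> \<bar>a i - b i\<bar> \<le> d"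
    and M: "M \<ge> 1" "card {i\<in>F. a i > 0} \<le> M" "card {i\<in>F. b i > 0} \<le> M"
    and common: "j \<in> F" "a j > 0" "b j > 0"
    and p: "p \<ge> 1" and R: "R > 0" "R powr p \<le> (\<Sum>i\<in>F. a i powr p)" "R powr p \<le> (\<Sum>i\<in>F. b i powr p)"
  shows "(\<Sum>i\<in>\<mu>. a i powr p) / (\<Sum>i\<in>F. a i powr p) - (\<Sum>i\<in>\<mu>. b i powr p) / (\<Sum>i\<in>F. b i powr p)
           \<le> p * ((real M - 1) powr (1 / p) / R) * d"
proof -
  define f where "f = (\<Sum>i\<in>\<mu>. a i powr p) powr (1 / p)"
  define g where "g = (\<Sum>i\<in>F-\<mu>. a i powr p) powr (1 / p)"
  define f' where "f' = (\<Sum>i\<in>\<mu>. b i powr p) powr (1 / p)"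
  define g' where "g' = (\<Sum>i\<in>F-\<mu>. b i powr p) powr (1 / p)"
  define m where "m = card {i\<in>\<mu>. a i > 0}"
  define n where "n = card {i\<in>F-\<mu>. b i > 0}"
  have fin: "finite \<mu>" using F finite_subset by blast
  have pw: "f powr p = (\<Sum>i\<in>\<mu>. a i powr p)" "g powr p = (\<Sum>i\<in>F-\<mu>. a i powr p)"
    "f' powr p = (\<Sum>i\<in>\<mu>. b i powr p)" "g' powr p = (\<Sum>i\<in>F-\<mu>. b i powr p)"
    using p by (auto simp: f_def g_def f'_def g'_def powr_powr sum_nonneg)
  have tot: "(\<Sum>i\<in>F. a i powr p) = f powr p + g powr p" "(\<Sum>i\<in>F. b i powr p) = f' powr p + g' powr p"
    unfolding pw using F by (auto simp: sum.subset_diff add.commute)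
  have ab: "a i \<le> b i + d" "b i \<le> a i + d" if "i \<in> F" for i using d(2)[OF that] by auto
  have df: "f - f' \<le> real m powr (1 / p) * d"
    unfolding f_def f'_def m_def
    using root_sum_powr_le_add_card[OF fin p d(1), of a b] nn ab F(2)
    by (simp add: subset_iff algebra_simps)
  have dg: "g' - g \<le> real n powr (1 / p) * d"
    unfolding g_def g'_def n_def
    using root_sum_powr_le_add_card[of "F - \<mu>" p d b a] p d(1) nn ab F(1)
    by (simp add: algebra_simps)
  have pm: "real k powr (1 / p) \<le> (real M - 1) powr (1 / p)" if "k \<le> M - 1" for k
    using that M p by (intro powr_mono2) auto
  have "(n \<le> M - 1 \<and> (m \<le> M - 1 \<or> (\<forall>i\<in>F-\<mu>. a i = 0))) \<or> ((\<forall>i\<in>\<mu>. b i = 0) \<and> m \<le> M - 1)"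
    unfolding m_def n_def by (rule crossing_supports_card) (use assms in auto)
  then have k: "real n powr (1 / p) \<le> (real M - 1) powr (1 / p) \<and>
      (real m powr (1 / p) \<le> (real M - 1) powr (1 / p) \<or> g = 0) \<or>
      f' = 0 \<and> real m powr (1 / p) \<le> (real M - 1) powr (1 / p)"
    using pm by (auto simp: g_def f'_def)
  have cross: "f * g' - f' * g \<le> (real M - 1) powr (1 / p) * d * (f + g)
      \<or> f * g' - f' * g \<le> (real M - 1) powr (1 / p) * d * (f' + g')"
    by (rule cross_difference_le[OF _ _ _ _ d(1) df dg k]) (auto simp: f_def g_def f'_def g'_def)
  have "f powr p / (f powr p + g powr p) - f' powr p / (f' powr p + g' powr p)
      \<le> p * ((real M - 1) powr (1 / p) * d) / R"
    by (rule powr_ratio_diff_le[OF _ _ _ _ p R(1) _ _ _ cross])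
       (use R d in \<open>auto simp: f_def g_def f'_def g'_def tot[symmetric, unfolded f_def g_def f'_def g'_def]\<close>)
  then show ?thesis by (simp add: tot pw(1,3)[symmetric])
qed

text \<open>The same comparison through the power sums themselves. The moduli of their variation contain the
  largest entry, so the hypothesis on \<open>E\<close> relates it to the total mass of either family: which
  of the two totals is cancelled depends on the splitting of the cross difference that is used.\<close>
lemma share_difference_le_max:
  fixes a b :: "'i \<Rightarrow> real"
  assumes F: "finite F" "\<mu> \<subseteq> F" and nn: "\<And>i. i \<in> F \<Longrightarrow> a i \<ge> 0" "\<And>i. i \<in> F \<Longrightarrow> b i \<ge> 0"
    and d: "d \<ge> 0" "\<And>i. i \<in> F \<Longrightarrow> \<bar>a i - b i\<bar> \<le> d"
    and M: "M \<ge> 1" "card {i\<in>F. a i > 0} \<le> M" "card {i\<in>F. b i > 0} \<le> M"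
    and common: "j \<in> F" "a j > 0" "b j > 0"
    and p: "p \<ge> 1"
    and c: "\<And>i. i \<in> F \<Longrightarrow> a i \<le> c" "\<And>i. i \<in> F \<Longrightarrow> b i \<le> c"
    and E: "c powr (p - 1) \<le> E * (\<Sum>i\<in>F. a i powr p)" "c powr (p - 1) \<le> E * (\<Sum>i\<in>F. b i powr p)"
  shows "(\<Sum>i\<in>\<mu>. a i powr p) / (\<Sum>i\<in>F. a i powr p) - (\<Sum>i\<in>\<mu>. b i powr p) / (\<Sum>i\<in>F. b i powr p)
           \<le> p * E * (real M - 1) * d"
proof -
  define A where "A = (\<Sum>i\<in>\<mu>. a i powr p)"
  define B where "B = (\<Sum>i\<in>F-\<mu>. a i powr p)"
  define A' where "A' = (\<Sum>i\<in>\<mu>. b i powr p)"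
  define B' where "B' = (\<Sum>i\<in>F-\<mu>. b i powr p)"
  define m where "m = card {i\<in>\<mu>. a i > 0}"
  define n where "n = card {i\<in>F-\<mu>. b i > 0}"
  define t where "t = p * c powr (p - 1) * d"
  have fin: "finite \<mu>" using F finite_subset by blast
  have tot: "(\<Sum>i\<in>F. a i powr p) = A + B" "(\<Sum>i\<in>F. b i powr p) = A' + B'"
    unfolding A_def B_def A'_def B'_def using F by (auto simp: sum.subset_diff add.commute)
  have pos: "A + B > 0" "A' + B' > 0"
    unfolding tot[symmetric] using common F by (auto intro!: sum_pos2[of F j])
  have t: "t \<ge> 0" using p d by (simp add: t_def)
  have ab: "a i \<le> b i + d" "b i \<le> a i + d" if "i \<in> F" for i using d(2)[OF that] by auto
  have dA: "A - A' \<le> real m * t"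
    unfolding A_def A'_def m_def t_def
    using sum_powr_diff_le_card[OF fin p d(1), of a b c] nn ab c F(2)
    by (simp add: subset_iff algebra_simps)
  have dB: "B' - B \<le> real n * t"
    unfolding B_def B'_def n_def t_def
    using sum_powr_diff_le_card[of "F - \<mu>" p d b a c] p d(1) nn ab F(1) c
    by (simp add: algebra_simps)
  have "(n \<le> M - 1 \<and> (m \<le> M - 1 \<or> (\<forall>i\<in>F-\<mu>. a i = 0))) \<or> ((\<forall>i\<in>\<mu>. b i = 0) \<and> m \<le> M - 1)"
    unfolding m_def n_def by (rule crossing_supports_card) (use assms in auto)
  then have k: "real n \<le> real (M - 1) \<and> (real m \<le> real (M - 1) \<or> B = 0) \<or> A' = 0 \<and> real m \<le> real (M - 1)"
    by (auto simp: B_def A'_def)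
  have cross: "A * B' - A' * B \<le> real (M - 1) * t * (A + B) \<or> A * B' - A' * B \<le> real (M - 1) * t * (A' + B')"
    by (rule cross_difference_le[OF _ _ _ _ t dA dB k]) (auto simp: A_def B_def A'_def B'_def sum_nonneg)
  have key: "real (M - 1) * t \<le> p * E * (real M - 1) * d * T" if "c powr (p - 1) \<le> E * T" for T
  proof -
    have "(real (M - 1) * p * d) * c powr (p - 1) \<le> (real (M - 1) * p * d) * (E * T)"
      using that p d by (intro mult_left_mono) auto
    then show ?thesis using M by (simp add: t_def of_nat_diff mult_ac)
  qed
  have "A * B' - A' * B \<le> p * E * (real M - 1) * d * ((A + B) * (A' + B'))"
    using cross
  proof
    assume "A * B' - A' * B \<le> real (M - 1) * t * (A + B)"
    also have "\<dots> \<le> p * E * (real M - 1) * d * (A' + B') * (A + B)"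
      using key[of "A' + B'"] E(2) pos by (intro mult_right_mono) (auto simp: tot)
    finally show ?thesis by (simp add: mult_ac)
  next
    assume "A * B' - A' * B \<le> real (M - 1) * t * (A' + B')"
    also have "\<dots> \<le> p * E * (real M - 1) * d * (A + B) * (A' + B')"
      using key[of "A + B"] E(1) pos by (intro mult_right_mono) (auto simp: tot)
    finally show ?thesis by (simp add: mult_ac)
  qed
  moreover have "A / (A + B) - A' / (A' + B') = (A * B' - A' * B) / ((A + B) * (A' + B'))"
    using pos by (simp add: diff_frac_eq algebra_simps)
  ultimately show ?thesis
    unfolding tot A_def[symmetric] A'_def[symmetric] using pos by (simp add: pos_divide_le_eq)
qed

section \<open>Covers without the whole space\<close>

text \<open>Also for \<open>V = UNIV\<close>, where the infimum is \<open>\<infinity>\<close>: both sides are then 0 by convention.\<close>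
lemma real_dist_compl: "real_of_ereal (dist_compl V x) = infdist x (- V)"
proof (cases "- V = {}")
  case True
  then show ?thesis by (simp add: dist_compl_def top_ereal_def infdist_def)
next
  case False
  have "(INF y\<in>- V. ereal (dist x y)) = ereal (infdist x (- V))"
  proof (rule antisym)
    show "ereal (infdist x (- V)) \<le> (INF y\<in>- V. ereal (dist x y))"
      by (intro INF_greatest) (auto intro: infdist_le)
    show "(INF y\<in>- V. ereal (dist x y)) \<le> ereal (infdist x (- V))"
    proof (rule ereal_le_epsilon2)
      fix e :: real assume "e > 0"
      then have "(INF y\<in>- V. dist x y) < infdist x (- V) + e" using False by (simp add: infdist_notempty)
      then obtain y where "y \<in> - V" "dist x y < infdist x (- V) + e"
        using False by (subst (asm) cINF_less_iff) auto
      then show "(INF y\<in>- V. ereal (dist x y)) \<le> ereal (infdist x (- V)) + ereal e"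
        by (intro INF_lower2[of y]) auto
    qed
  qed
  then show ?thesis by (simp add: dist_compl_def)
qed

lemma supp_sum_eq_sum:
  assumes "finite F" "F \<subseteq> S" "\<And>i. i \<in> S - F \<Longrightarrow> f i = 0"
  shows "supp_sum f S = sum f F"
  unfolding supp_sum_def using assms
  by (intro sum.mono_neutral_left) (auto simp: support_on_def)

locale proper_cover =
  fixes K :: "'k set" and U :: "'k \<Rightarrow> 'a::metric_space set" and L p :: real and M :: nat
  assumes cover: "open_cover K U" and leb: "lebesgue_number K U L" and mult: "has_multiplicity K U M"
    and M: "M \<ge> 1" and p: "p \<ge> 1" and proper: "\<And>\<alpha>. \<alpha> \<in> K \<Longrightarrow> U \<alpha> \<noteq> UNIV"
begin

definition depth :: "'k \<Rightarrow> 'a \<Rightarrow> real" where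
  "depth \<alpha> x = infdist x (- U \<alpha>)"

definition members :: "'a \<Rightarrow> 'k set" where
  "members x = {\<alpha>\<in>K. x \<in> U \<alpha>}"

definition mass :: "'a \<Rightarrow> real" where
  "mass x = (\<Sum>\<alpha>\<in>members x. depth \<alpha> x powr p)"

lemma L_pos: "L > 0"
  using leb by (simp add: lebesgue_number_def)

lemma members_subset: "members x \<subseteq> K"
  by (auto simp: members_def)

lemma finite_members: "finite (members x)" and card_members: "card (members x) \<le> M"
  using mult by (auto simp: members_def has_multiplicity_def)

lemma depth_nonneg: "depth \<alpha> x \<ge> 0"
  by (simp add: depth_def infdist_nonneg)

lemma depth_lipschitz: "\<bar>depth \<alpha> x - depth \<alpha> y\<bar> \<le> dist x y"
  unfolding depth_def by (rule infdist_triangle_abs)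

lemma depth_pos_iff: "\<alpha> \<in> K \<Longrightarrow> depth \<alpha> x > 0 \<longleftrightarrow> x \<in> U \<alpha>"
proof -
  assume \<alpha>: "\<alpha> \<in> K"
  have "closed (- U \<alpha>)" "- U \<alpha> \<noteq> {}"
    using cover proper \<alpha> by (auto simp: open_cover_def)
  then have "x \<in> - U \<alpha> \<longleftrightarrow> depth \<alpha> x = 0"
    unfolding depth_def by (rule in_closed_iff_infdist_zero)
  then show ?thesis using depth_nonneg[of \<alpha> x] by auto
qed

lemma depth_eq_0: "\<alpha> \<in> K \<Longrightarrow> \<alpha> \<notin> members x \<Longrightarrow> depth \<alpha> x = 0"
  using depth_pos_iff[of \<alpha> x] depth_nonneg[of \<alpha> x] by (auto simp: members_def)

lemma ball_subset_imp_depth_ge: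
  assumes "\<alpha> \<in> K" "ball x r \<subseteq> U \<alpha>"
  shows "r \<le> depth \<alpha> x"
proof -
  have "- U \<alpha> \<noteq> {}" using proper assms by blast
  then show ?thesis
    unfolding depth_def infdist_notempty[OF \<open>- U \<alpha> \<noteq> {}\<close>]
    using assms by (intro cINF_greatest) (auto simp: subset_iff not_less[symmetric])
qed

lemma deepest_member:
  obtains \<alpha> where "\<alpha> \<in> members x" "depth \<alpha> x \<ge> L" "\<And>\<beta>. \<beta> \<in> K \<Longrightarrow> depth \<beta> x \<le> depth \<alpha> x"
proof -
  obtain \<beta> where \<beta>: "\<beta> \<in> K" "ball x L \<subseteq> U \<beta>" using leb unfolding lebesgue_number_def by blast
  then have b: "L \<le> depth \<beta> x" "\<beta> \<in> members x"
    using ball_subset_imp_depth_ge L_pos by (auto simp: members_def)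
  define m where "m = Max ((\<lambda>\<gamma>. depth \<gamma> x) ` members x)"
  have "m \<in> (\<lambda>\<gamma>. depth \<gamma> x) ` members x"
    unfolding m_def using b finite_members by (intro Max_in) auto
  then obtain \<alpha> where \<alpha>: "\<alpha> \<in> members x" "depth \<alpha> x = m" by auto
  have le: "depth \<gamma> x \<le> depth \<alpha> x" if "\<gamma> \<in> K" for \<gamma>
  proof (cases "\<gamma> \<in> members x")
    case True
    then show ?thesis unfolding \<alpha>(2) m_def using finite_members by (intro Max_ge) auto
  next
    case False
    then show ?thesis using that depth_eq_0 depth_nonneg by simp
  qed
  have "L \<le> depth \<alpha> x" using le[OF \<beta>(1)] b(1) by linarith
  then show thesis using \<alpha>(1) le that by blast
qed

lemma mass_ge: "L powr p \<le> mass x"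
proof -
  obtain \<alpha> where \<alpha>: "\<alpha> \<in> members x" "depth \<alpha> x \<ge> L" using deepest_member by blast
  have "L powr p \<le> depth \<alpha> x powr p" using \<alpha> L_pos p by (intro powr_mono2) auto
  also have "\<dots> \<le> mass x"
    unfolding mass_def using \<alpha> finite_members by (intro member_le_sum) auto
  finally show ?thesis .
qed

lemma mass_pos: "mass x > 0"
  using mass_ge[of x] L_pos powr_gt_zero[of L p] by linarith

lemma cover_fun_eq: "cover_fun K U p \<alpha> x = depth \<alpha> x powr p / mass x"
proof -
  have "supp_sum (\<lambda>\<beta>. depth \<beta> x powr p) K = mass x"
    unfolding mass_def using finite_members members_subset depth_eq_0 by (intro supp_sum_eq_sum) auto
  then show ?thesis
    using proper by (auto simp: cover_fun_def real_dist_compl depth_def)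
qed

lemma mass_eq_sum:
  assumes "finite F" "members x \<subseteq> F" "F \<subseteq> K"
  shows "mass x = (\<Sum>\<alpha>\<in>F. depth \<alpha> x powr p)"
  unfolding mass_def using assms depth_eq_0 by (intro sum.mono_neutral_left) auto

lemma cover_fun_sum_eq:
  assumes "finite F" "members x \<subseteq> F" "\<mu> \<subseteq> K"
  shows "cover_fun_sum K U p \<mu> x = (\<Sum>\<alpha>\<in>F\<inter>\<mu>. depth \<alpha> x powr p) / mass x"
proof -
  have "cover_fun_sum K U p \<mu> x = (\<Sum>\<alpha>\<in>F\<inter>\<mu>. depth \<alpha> x powr p / mass x)"
    unfolding cover_fun_sum_def cover_fun_eq
    using assms depth_eq_0 by (intro supp_sum_eq_sum) auto
  then show ?thesis by (simp add: sum_divide_distrib)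
qed

text \<open>This is where \<open>dist x y < L\<close> enters: the deepest set at \<open>x\<close> still contains \<open>y\<close>.\<close>
lemma common_member:
  assumes "dist x y < L"
  obtains \<alpha> where "\<alpha> \<in> members x" "depth \<alpha> x > 0" "depth \<alpha> y > 0"
proof -
  obtain \<alpha> where \<alpha>: "\<alpha> \<in> members x" "depth \<alpha> x \<ge> L" using deepest_member by blast
  then have "depth \<alpha> y > 0" using depth_lipschitz[of \<alpha> x y] assms by linarith
  then show thesis using that \<alpha> L_pos by auto
qed

lemma card_positive_depth:
  assumes "F \<subseteq> K"
  shows "card {\<alpha>\<in>F. depth \<alpha> x > 0} \<le> M"
proof -
  have "{\<alpha>\<in>F. depth \<alpha> x > 0} \<subseteq> members x" using assms depth_pos_iff by (auto simp: members_def)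
  then show ?thesis using card_mono[OF finite_members] card_members[of x] by (meson order_trans)
qed

text \<open>The lower bound \<open>R\<close> is left open: it is \<open>L\<close> in a general space and \<open>2\<^bsup>1/p\<^esup> L\<close> in the presence of
  approximate midpoints.\<close>
lemma cover_fun_sum_diff_le_norm:
  assumes \<mu>: "\<mu> \<subseteq> K" and R: "R > 0" "\<And>z. R powr p \<le> mass z" and xy: "dist x y < L"
  shows "\<bar>cover_fun_sum K U p \<mu> x - cover_fun_sum K U p \<mu> y\<bar>
           \<le> p * ((real M - 1) powr (1 / p) / R) * dist x y"
proof -
  have *: "cover_fun_sum K U p \<mu> x - cover_fun_sum K U p \<mu> y
      \<le> p * ((real M - 1) powr (1 / p) / R) * dist x y" if xy: "dist x y < L" for x y
  proof -
    define F where "F = members x \<union> members y"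
    have F: "finite F" "members x \<subseteq> F" "members y \<subseteq> F" "F \<subseteq> K"
      using finite_members members_subset by (auto simp: F_def)
    obtain j where j: "j \<in> members x" "depth j x > 0" "depth j y > 0" using common_member[OF xy] .
    have tot: "mass x = (\<Sum>\<alpha>\<in>F. depth \<alpha> x powr p)" "mass y = (\<Sum>\<alpha>\<in>F. depth \<alpha> y powr p)"
      using F by (auto intro!: mass_eq_sum)
    show ?thesis
      unfolding cover_fun_sum_eq[OF F(1,2) \<mu>] cover_fun_sum_eq[OF F(1,3) \<mu>] tot
      by (rule share_difference_le_norm[where j = j])
        (use F j p M R depth_nonneg depth_lipschitz card_positive_depth in \<open>auto simp flip: tot\<close>)
  qed
  show ?thesis using *[of x y] *[of y x] xy by (simp add: dist_commute abs_le_iff)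
qed

text \<open>The hypothesis relates the depth and the mass at one and the same point, while the comparison
  needs the larger of the two maximal depths against both masses. Passing from one point to the other
  costs the factor \<open>(1 + r / L)\<^bsup>p-1\<^esup>\<close>, which disappears as \<open>r\<close> tends to 0.\<close>
lemma cover_fun_sum_diff_le_max:
  assumes \<mu>: "\<mu> \<subseteq> K" and r: "r \<le> L" and xy: "dist x y < r"
    and E: "E \<ge> 0" "\<And>z \<alpha>. \<alpha> \<in> K \<Longrightarrow> depth \<alpha> z powr (p - 1) \<le> E * mass z"
  shows "\<bar>cover_fun_sum K U p \<mu> x - cover_fun_sum K U p \<mu> y\<bar>
           \<le> p * ((1 + r / L) powr (p - 1) * E) * (real M - 1) * dist x y"
proof -
  have *: "cover_fun_sum K U p \<mu> x - cover_fun_sum K U p \<mu> y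
      \<le> p * ((1 + r / L) powr (p - 1) * E) * (real M - 1) * dist x y" if xy: "dist x y < r" for x y
  proof -
    define F where "F = members x \<union> members y"
    have F: "finite F" "members x \<subseteq> F" "members y \<subseteq> F" "F \<subseteq> K"
      using finite_members members_subset by (auto simp: F_def)
    have r0: "r > 0" using xy zero_le_dist[of x y] by linarith
    obtain j where j: "j \<in> members x" "depth j x > 0" "depth j y > 0"
      using common_member[of x y] xy r by auto
    have tot: "mass x = (\<Sum>\<alpha>\<in>F. depth \<alpha> x powr p)" "mass y = (\<Sum>\<alpha>\<in>F. depth \<alpha> y powr p)"
      using F by (auto intro!: mass_eq_sum)
    obtain \<alpha> where \<alpha>: "\<alpha> \<in> members x" "depth \<alpha> x \<ge> L" "\<And>\<gamma>. \<gamma> \<in> K \<Longrightarrow> depth \<gamma> x \<le> depth \<alpha> x"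
      using deepest_member[of x] by blast
    obtain \<beta> where \<beta>: "\<beta> \<in> members y" "depth \<beta> y \<ge> L" "\<And>\<gamma>. \<gamma> \<in> K \<Longrightarrow> depth \<gamma> y \<le> depth \<beta> y"
      using deepest_member[of y] by blast
    have \<alpha>K: "\<alpha> \<in> K" and \<beta>K: "\<beta> \<in> K" using \<alpha> \<beta> members_subset by auto
    define c where "c = max (depth \<alpha> x) (depth \<beta> y)"
    \<comment> \<open>Both depths are maximal at their points, so their difference is below \<open>r\<close>.\<close>
    have near: "depth \<alpha> x \<le> depth \<beta> y + r" "depth \<beta> y \<le> depth \<alpha> x + r"
      using \<alpha>(3)[OF \<beta>K] \<beta>(3)[OF \<alpha>K] depth_lipschitz[of \<alpha> x y] depth_lipschitz[of \<beta> x y] xy by auto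
    have c: "c powr (p - 1) \<le> (1 + r / L) powr (p - 1) * E * mass z"
      if "\<gamma> \<in> K" "depth \<gamma> z \<ge> L" "c \<le> depth \<gamma> z + r" for z \<gamma>
    proof -
      have "r * 1 \<le> r * (depth \<gamma> z / L)" using that r0 L_pos by (intro mult_left_mono) auto
      then have "c \<le> (1 + r / L) * depth \<gamma> z" using that by (simp add: algebra_simps)
      moreover have "c \<ge> 0" using depth_nonneg by (simp add: c_def le_max_iff_disj)
      ultimately have "c powr (p - 1) \<le> ((1 + r / L) * depth \<gamma> z) powr (p - 1)"
        using p by (intro powr_mono2) auto
      also have "\<dots> = (1 + r / L) powr (p - 1) * depth \<gamma> z powr (p - 1)"
        using r0 L_pos depth_nonneg by (simp add: powr_mult)
      also have "\<dots> \<le> (1 + r / L) powr (p - 1) * (E * mass z)"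
        using E(2) that by (intro mult_left_mono) auto
      finally show ?thesis by (simp add: mult.assoc)
    qed
    have cx: "c powr (p - 1) \<le> (1 + r / L) powr (p - 1) * E * mass x"
      by (rule c[OF \<alpha>K \<alpha>(2)]) (use near r0 in \<open>auto simp: c_def\<close>)
    have cy: "c powr (p - 1) \<le> (1 + r / L) powr (p - 1) * E * mass y"
      by (rule c[OF \<beta>K \<beta>(2)]) (use near r0 in \<open>auto simp: c_def\<close>)
    have cmax: "depth \<gamma> x \<le> c" "depth \<gamma> y \<le> c" if "\<gamma> \<in> F" for \<gamma>
      using \<alpha>(3)[of \<gamma>] \<beta>(3)[of \<gamma>] that F by (auto simp: c_def le_max_iff_disj)
    show ?thesis
      unfolding cover_fun_sum_eq[OF F(1,2) \<mu>] cover_fun_sum_eq[OF F(1,3) \<mu>] tot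
      by (rule share_difference_le_max[where j = j and c = c])
        (use F j p M cx cy cmax depth_nonneg depth_lipschitz card_positive_depth in \<open>auto simp flip: tot\<close>)
  qed
  show ?thesis using *[of x y] *[of y x] xy by (simp add: dist_commute abs_le_iff)
qed

lemma cover_fun_sum_range:
  assumes "\<mu> \<subseteq> K"
  shows "cover_fun_sum K U p \<mu> x \<in> {0..1}"
proof -
  have "(\<Sum>\<alpha>\<in>members x\<inter>\<mu>. depth \<alpha> x powr p) \<le> mass x"
    unfolding mass_def using finite_members by (intro sum_mono2) auto
  then show ?thesis
    unfolding cover_fun_sum_eq[OF finite_members order.refl assms]
    using mass_pos[of x] by (auto intro!: divide_nonneg_pos sum_nonneg)
qed

lemma cover_fun_sum_lipschitz:
  assumes \<mu>: "\<mu> \<subseteq> K"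
  shows "\<bar>cover_fun_sum K U p \<mu> x - cover_fun_sum K U p \<mu> y\<bar>
           \<le> p * (max 1 (real M - 1) powr (1 / p) / L) * dist x y"
proof (cases "dist x y < L")
  case True
  have "\<bar>cover_fun_sum K U p \<mu> x - cover_fun_sum K U p \<mu> y\<bar>
      \<le> p * ((real M - 1) powr (1 / p) / L) * dist x y"
    by (rule cover_fun_sum_diff_le_norm[OF \<mu> L_pos mass_ge True])
  also have "\<dots> \<le> p * (max 1 (real M - 1) powr (1 / p) / L) * dist x y"
    using p M L_pos by (intro mult_right_mono mult_left_mono divide_right_mono powr_mono2) auto
  finally show ?thesis .
next
  case False
  have "1 \<le> max 1 (real M - 1) powr (1 / p)" using p by (intro ge_one_powr_ge_zero) auto
  then have "1 * 1 \<le> p * max 1 (real M - 1) powr (1 / p)" using p by (intro mult_mono) auto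
  moreover have "1 \<le> dist x y / L" using False L_pos by simp
  ultimately have "1 * 1 \<le> p * max 1 (real M - 1) powr (1 / p) * (dist x y / L)" by (intro mult_mono) auto
  then show ?thesis
    using cover_fun_sum_range[OF \<mu>, of x] cover_fun_sum_range[OF \<mu>, of y] by auto
qed

lemma cover_fun_continuous:
  assumes "\<alpha> \<in> K"
  shows "continuous_on UNIV (cover_fun K U p \<alpha>)"
proof -
  let ?C = "p * (max 1 (real M - 1) powr (1 / p) / L)"
  have eq: "cover_fun_sum K U p {\<alpha>} x = cover_fun K U p \<alpha> x" for x
    unfolding cover_fun_sum_def by (simp add: supp_sum_eq_sum[of "{\<alpha>}"])
  have "?C-lipschitz_on UNIV (cover_fun K U p \<alpha>)"
    using cover_fun_sum_lipschitz[of "{\<alpha>}"] assms p L_pos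
    by (intro lipschitz_onI) (auto simp: eq dist_real_def)
  then show ?thesis by (rule lipschitz_on_continuous_on)
qed

lemma cover_fun_partition_of_unity: "partition_of_unity K (cover_fun K U p)"
  unfolding partition_of_unity_def
proof (intro conjI ballI allI)
  fix x
  have sub: "{\<alpha>\<in>K. cover_fun K U p \<alpha> x \<noteq> 0} \<subseteq> members x"
    using depth_eq_0 by (auto simp: cover_fun_eq)
  then show "finite {\<alpha>\<in>K. cover_fun K U p \<alpha> x \<noteq> 0}"
    using finite_members finite_subset by blast
  show "supp_sum (\<lambda>\<alpha>. cover_fun K U p \<alpha> x) K = 1"
    using cover_fun_sum_eq[OF finite_members order.refl order.refl, of x] mass_pos[of x] members_subset[of x]
    by (simp add: cover_fun_sum_def mass_def Int_absorb2)
qed (auto simp: cover_fun_eq mass_pos less_imp_le intro: cover_fun_continuous[unfolded cover_fun_eq[abs_def]])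

lemma cover_fun_subordinate: "subordinate_to K (cover_fun K U p) U"
  unfolding subordinate_to_def
proof (intro ballI subsetI)
  fix \<alpha> x assume "\<alpha> \<in> K" "x \<in> {x. cover_fun K U p \<alpha> x > 0}"
  then show "x \<in> U \<alpha>" using depth_eq_0[of \<alpha> x] by (cases "x \<in> U \<alpha>") (auto simp: cover_fun_eq members_def)
qed

text \<open>Let \<open>w\<close> be a nearly closest point of the complement of the deepest set \<open>U \<alpha>\<close>, and \<open>z\<close> a point
  between \<open>x\<close> and \<open>w\<close> at distance just below \<open>L\<close> from \<open>w\<close>. A set that contains the ball of radius
  \<open>L\<close> around \<open>z\<close> contains \<open>w\<close> and so differs from \<open>U \<alpha>\<close>; its depth drops by at most \<open>depth \<alpha> x - L\<close>,
  up to a small error, on the way from \<open>z\<close> back to \<open>x\<close>. Taking for \<open>t\<close> the second largest depth, or 0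
  if \<open>x\<close> lies in one set only, makes the statement free of errors.\<close>
lemma two_deepest:
  assumes mid: "approx_midpoint_property (UNIV :: 'a set)"
  obtains \<alpha> t where "\<alpha> \<in> K" "\<And>\<beta>. \<beta> \<in> K \<Longrightarrow> depth \<beta> x \<le> depth \<alpha> x"
    "0 \<le> t" "t \<le> depth \<alpha> x" "2 * L \<le> depth \<alpha> x + t" "depth \<alpha> x powr p + t powr p \<le> mass x"
proof -
  obtain \<alpha> where \<alpha>: "\<alpha> \<in> members x" "depth \<alpha> x \<ge> L" "\<And>\<beta>. \<beta> \<in> K \<Longrightarrow> depth \<beta> x \<le> depth \<alpha> x"
    using deepest_member[of x] by blast
  define m where "m = depth \<alpha> x"
  define T where "T = insert 0 ((\<lambda>\<gamma>. depth \<gamma> x) ` (members x - {\<alpha>}))"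
  define t where "t = Max T"
  have T: "finite T" "T \<noteq> {}" using finite_members by (auto simp: T_def)
  have "t \<in> T" unfolding t_def using T by (rule Max_in)
  then consider "t = 0" | \<gamma> where "\<gamma> \<in> members x" "\<gamma> \<noteq> \<alpha>" "t = depth \<gamma> x" by (auto simp: T_def)
  then have t: "t \<le> m \<and> m powr p + t powr p \<le> mass x"
  proof cases
    case 1
    have "m powr p \<le> mass x"
      unfolding m_def mass_def using \<alpha> finite_members by (intro member_le_sum) auto
    then show ?thesis using 1 \<alpha> L_pos by (simp add: m_def depth_nonneg)
  next
    case 2
    have "(\<Sum>\<beta>\<in>{\<alpha>, \<gamma>}. depth \<beta> x powr p) \<le> mass x"
      unfolding mass_def using \<alpha> 2 finite_members by (intro sum_mono2) auto
    then show ?thesis using 2 \<alpha>(3)[of \<gamma>] members_subset by (auto simp: m_def)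
  qed
  have t_ge: "depth \<gamma> x \<le> t" if "\<gamma> \<in> K" "\<gamma> \<noteq> \<alpha>" for \<gamma>
  proof (cases "\<gamma> \<in> members x")
    case False
    then have "depth \<gamma> x \<in> T" using that by (simp add: T_def depth_eq_0)
    then show ?thesis unfolding t_def using T by simp
  next
    case True
    then have "depth \<gamma> x \<in> T" using that by (simp add: T_def)
    then show ?thesis unfolding t_def using T by simp
  qed
  have "2 * L \<le> m + t"
  proof (rule field_le_epsilon)
    fix e :: real assume e: "e > 0"
    have ne: "- U \<alpha> \<noteq> {}" using proper \<alpha>(1) members_subset by blast
    have "(INF w\<in>- U \<alpha>. dist x w) < m + e / 2"
      using e by (simp add: m_def depth_def flip: infdist_notempty[OF ne])
    then obtain w where w: "w \<notin> U \<alpha>" "dist x w < m + e / 2"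
      using ne by (subst (asm) cINF_less_iff) auto
    have "m \<le> dist x w" unfolding m_def depth_def using w by (intro infdist_le) auto
    then have "dist x w - L + e / 2 > 0" using \<alpha>(2) e by (simp add: m_def)
    then obtain z where z: "dist x z < dist x w - L + e / 2" "dist z w < L"
      using approx_between[OF mid, of "dist x w - L + e / 2" L x w] L_pos e by auto
    obtain \<gamma> where \<gamma>: "\<gamma> \<in> K" "ball z L \<subseteq> U \<gamma>" using leb unfolding lebesgue_number_def by blast
    have "\<gamma> \<noteq> \<alpha>" using \<gamma> w z by auto
    then have "depth \<gamma> x \<le> t" using t_ge \<gamma> by blast
    moreover have "L \<le> depth \<gamma> z" using ball_subset_imp_depth_ge \<gamma> by blast
    ultimately show "2 * L \<le> m + t + e" using depth_lipschitz[of \<gamma> x z] z w by linarith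
  qed
  moreover have "0 \<le> t" unfolding t_def using T by (intro Max_ge) (auto simp: T_def)
  ultimately show thesis using that[of \<alpha> t] \<alpha> t members_subset by (auto simp: m_def)
qed

text \<open>\<open>L\<close> is at most the mean of the two largest depths, so convexity of \<open>x\<^sup>p\<close> gives \<open>2 L\<^sup>p\<close>.\<close>
lemma mass_ge_midpoint:
  assumes mid: "approx_midpoint_property (UNIV :: 'a set)"
  shows "(2 powr (1 / p) * L) powr p \<le> mass x"
proof -
  obtain \<alpha> t where t: "\<alpha> \<in> K" "0 \<le> t" "t \<le> depth \<alpha> x" "2 * L \<le> depth \<alpha> x + t"
    "depth \<alpha> x powr p + t powr p \<le> mass x"
    using two_deepest[OF mid, of x] by blast
  have "L powr p \<le> (1/2 * depth \<alpha> x + (1 - 1/2) * t) powr p"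
    using t L_pos p by (intro powr_mono2) auto
  also have "\<dots> \<le> 1/2 * depth \<alpha> x powr p + (1 - 1/2) * t powr p"
    using t p by (intro powr_convex_nonneg) auto
  finally have "2 * L powr p \<le> mass x" using t(5) by simp
  then show ?thesis using p L_pos by (simp add: powr_mult powr_powr)
qed

lemma depth_powr_le_mass_midpoint:
  assumes mid: "approx_midpoint_property (UNIV :: 'a set)" and \<beta>: "\<beta> \<in> K"
  shows "depth \<beta> x powr (p - 1) \<le> C_const p / (2 * L) * mass x"
proof -
  obtain \<alpha> t where t: "\<alpha> \<in> K" "\<And>\<beta>. \<beta> \<in> K \<Longrightarrow> depth \<beta> x \<le> depth \<alpha> x"
    "0 \<le> t" "t \<le> depth \<alpha> x" "2 * L \<le> depth \<alpha> x + t"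
    "depth \<alpha> x powr p + t powr p \<le> mass x"
    using two_deepest[OF mid, of x] by blast
  have "depth \<beta> x powr (p - 1) \<le> depth \<alpha> x powr (p - 1)"
    using t(2)[OF \<beta>] p depth_nonneg by (intro powr_mono2) auto
  also have "\<dots> \<le> C_const p / (2 * L) * (depth \<alpha> x powr p + t powr p)"
    using t by (intro powr_div_sum_le_C_const[OF p L_pos]) auto
  also have "\<dots> \<le> C_const p / (2 * L) * mass x"
    using t(6) C_const_range[OF p] L_pos by (intro mult_left_mono) auto
  finally show ?thesis .
qed

lemma cover_fun_sum_lipschitz_midpoint_norm:
  assumes mid: "approx_midpoint_property (UNIV :: 'a set)" and \<mu>: "\<mu> \<subseteq> K"
  shows "\<bar>cover_fun_sum K U p \<mu> x - cover_fun_sum K U p \<mu> y\<bar>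
           \<le> p * 2 powr (1 - 1 / p) * ((real M - 1) powr (1 / p) / (2 * L)) * dist x y"
proof -
  have "\<bar>cover_fun_sum K U p \<mu> x - cover_fun_sum K U p \<mu> y\<bar>
      \<le> p * ((real M - 1) powr (1 / p) / (2 powr (1 / p) * L)) * dist x y"
  proof (rule local_lipschitz_imp_lipschitz[OF mid L_pos])
    show "0 \<le> p * ((real M - 1) powr (1 / p) / (2 powr (1 / p) * L))" using p L_pos by simp
  qed (rule cover_fun_sum_diff_le_norm[OF \<mu> _ mass_ge_midpoint[OF mid]], use L_pos in auto)
  also have "\<dots> = p * 2 powr (1 - 1 / p) * ((real M - 1) powr (1 / p) / (2 * L)) * dist x y"
    using L_pos by (simp add: powr_diff)
  finally show ?thesis .
qed

text \<open>The local constants on the scale \<open>r\<close> become global ones first; only then \<open>r\<close> tends to 0 for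
  fixed \<open>x\<close> and \<open>y\<close>.\<close>
lemma cover_fun_sum_lipschitz_midpoint_max:
  assumes mid: "approx_midpoint_property (UNIV :: 'a set)" and \<mu>: "\<mu> \<subseteq> K"
  shows "\<bar>cover_fun_sum K U p \<mu> x - cover_fun_sum K U p \<mu> y\<bar>
           \<le> p * C_const p * ((real M - 1) / (2 * L)) * dist x y"
proof -
  define E where "E = C_const p / (2 * L)"
  have E: "E \<ge> 0" using C_const_range[OF p] L_pos by (simp add: E_def)
  define G where "G = (\<lambda>r. p * ((1 + r / L) powr (p - 1) * E) * (real M - 1) * dist x y)"
  have le: "\<bar>cover_fun_sum K U p \<mu> x - cover_fun_sum K U p \<mu> y\<bar> \<le> G r" if r: "0 < r" "r < L" for r
    unfolding G_def
  proof (rule local_lipschitz_imp_lipschitz[OF mid r(1)])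
    show "0 \<le> p * ((1 + r / L) powr (p - 1) * E) * (real M - 1)" using p M E by simp
  next
    fix x y :: 'a assume xy: "dist x y < r"
    show "\<bar>cover_fun_sum K U p \<mu> x - cover_fun_sum K U p \<mu> y\<bar>
        \<le> p * ((1 + r / L) powr (p - 1) * E) * (real M - 1) * dist x y"
      using depth_powr_le_mass_midpoint[OF mid] r(2) E
      by (intro cover_fun_sum_diff_le_max[OF \<mu> _ xy]) (auto simp: E_def)
  qed
  have "(G \<longlongrightarrow> p * ((1 + 0 / L) powr (p - 1) * E) * (real M - 1) * dist x y) (at_right 0)"
    unfolding G_def using L_pos by (intro tendsto_intros) auto
  moreover have "eventually (\<lambda>r. \<bar>cover_fun_sum K U p \<mu> x - cover_fun_sum K U p \<mu> y\<bar> \<le> G r) (at_right 0)"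
    using eventually_at_right_real[OF L_pos] by eventually_elim (auto intro: le)
  ultimately have "\<bar>cover_fun_sum K U p \<mu> x - cover_fun_sum K U p \<mu> y\<bar>
      \<le> p * ((1 + 0 / L) powr (p - 1) * E) * (real M - 1) * dist x y"
    by (intro tendsto_lowerbound) auto
  then show ?thesis by (simp add: E_def)
qed

end

section \<open>Covers containing the whole space, and the conclusion\<close>

lemma cover_fun_whole_space:
  assumes "\<exists>\<beta>\<in>K. U \<beta> = UNIV" and fin: "pointwise_finite K U"
  shows "partition_of_unity K (cover_fun K U p)" "subordinate_to K (cover_fun K U p) U"
    "cover_fun_sum K U p \<mu> x = cover_fun_sum K U p \<mu> y"
proof -
  let ?W = "{\<beta>\<in>K. U \<beta> = UNIV}"
  have eq: "cover_fun K U p \<alpha> x = (if U \<alpha> = UNIV then 1 / real (card ?W) else 0)" for \<alpha> x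
    using assms(1) by (simp add: cover_fun_def)
  have W: "finite ?W"
    by (rule finite_subset[of _ "{\<alpha>\<in>K. x \<in> U \<alpha>}"]) (use fin in \<open>auto simp: pointwise_finite_def\<close>)
  have card: "card ?W > 0" using assms(1) W by (auto simp: card_gt_0_iff)
  have "supp_sum (\<lambda>\<alpha>. cover_fun K U p \<alpha> x) K = (\<Sum>\<alpha>\<in>?W. cover_fun K U p \<alpha> x)" for x
    using W by (intro supp_sum_eq_sum) (auto simp: eq)
  then have "supp_sum (\<lambda>\<alpha>. cover_fun K U p \<alpha> x) K = 1" for x
    using card by (simp add: eq)
  moreover have "finite {\<alpha>\<in>K. cover_fun K U p \<alpha> x \<noteq> 0}" for x
    by (rule finite_subset[OF _ W]) (auto simp: eq)
  ultimately show "partition_of_unity K (cover_fun K U p)"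
    unfolding partition_of_unity_def by (auto simp: eq[abs_def])
  show "subordinate_to K (cover_fun K U p) U" by (auto simp: subordinate_to_def eq)
  show "cover_fun_sum K U p \<mu> x = cover_fun_sum K U p \<mu> y" by (simp add: cover_fun_sum_def eq)
qed

theorem theorem3p4:
  fixes U :: "'k \<Rightarrow> 'a::metric_space set" and K :: "'k set"
    and L p :: real and M :: nat
  assumes "open_cover K U"
    and "pointwise_finite K U"
    and "lebesgue_number K U L"
    and "has_multiplicity K U M"
    and "M \<ge> 1"
    and "p \<ge> 1"
  shows "partition_of_unity K (cover_fun K U p) \<and>
    subordinate_to K (cover_fun K U p) U \<and>
    (\<forall>\<mu>\<subseteq>K. \<forall>x y.
       \<bar>cover_fun_sum K U p \<mu> x - cover_fun_sum K U p \<mu> y\<bar>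
         \<le> p * (max 1 (real M - 1) powr (1 / p) / L) * dist x y) \<and>
    (approx_midpoint_property (UNIV :: 'a set) \<longrightarrow>
      (\<forall>\<mu>\<subseteq>K. \<forall>x y.
         \<bar>cover_fun_sum K U p \<mu> x - cover_fun_sum K U p \<mu> y\<bar>
           \<le> p * 2 powr (1 - 1 / p) * ((real M - 1) powr (1 / p) / (2 * L)) * dist x y \<and>
         \<bar>cover_fun_sum K U p \<mu> x - cover_fun_sum K U p \<mu> y\<bar>
           \<le> p * C_const p * ((real M - 1) / (2 * L)) * dist x y)) \<and>
    (\<exists>\<eta>\<in>{1/2..1}. C_ratio p \<eta> = C_const p \<and> (\<forall>\<zeta>\<in>{1/2..1}. C_ratio p \<zeta> \<le> C_const p)) \<and>
    C_const p \<in> {1..<2}"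
proof -
  have attained: "\<exists>\<eta>\<in>{1/2..1}. C_ratio p \<eta> = C_const p \<and> (\<forall>\<zeta>\<in>{1/2..1}. C_ratio p \<zeta> \<le> C_const p)"
    by (rule C_const_attained[OF assms(6)]) auto
  note C = C_const_range[OF assms(6)]
  show ?thesis
  proof (cases "\<exists>\<beta>\<in>K. U \<beta> = UNIV")
    case True
    have L: "L > 0" using assms(3) by (simp add: lebesgue_number_def)
    have zero: "\<bar>cover_fun_sum K U p \<mu> x - cover_fun_sum K U p \<mu> y\<bar> = 0" for \<mu> x y
      using cover_fun_whole_space(3)[OF True assms(2), of p \<mu> x y] by simp
    show ?thesis
      using cover_fun_whole_space(1,2)[OF True assms(2), of p] attained C assms(5,6) L
      by (simp add: zero)
  next
    case False
    interpret proper_cover K U L p M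
      by unfold_locales (use assms False in auto)
    show ?thesis
      by (intro conjI allI impI cover_fun_partition_of_unity cover_fun_subordinate attained C
          cover_fun_sum_lipschitz cover_fun_sum_lipschitz_midpoint_norm
          cover_fun_sum_lipschitz_midpoint_max)
  qed
qed

end
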